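(* Let $H=(H_1,\ldots,H_n,p_1,\ldots,p_n)$ be a strategic game and let $\overline{\phi}=(\phi_1,\ldots,\phi_n)$ be properties such that each $\phi_i$ satisfies the condition ($\mathbf{A}$) for all restrictions $G=(G_1,\ldots,G_n)$ and $G'=(G'_1,\ldots,G'_n)$ of $H$ such that $G_j=G'_j$ for all $j\neq i$, and all $s_i\in H_i$: $\phi_i(s_i,G)\leftrightarrow\phi_i(s_i,G')$. Then $\langle\overline{\phi}\rangle^\infty$, the iterated effect of the public announcements of rationality $\langle\overline{\phi}\rangle$ starting with the standard knowledge model for $H$, is the standard knowledge model for the restriction $T^\infty_{\overline{\phi}}$.
   Context: A strategic game $H=(H_1,\ldots,H_n,p_1,\ldots,p_n)$ ($n>1$) consists of non-empty strategy sets $H_i$ (arbitrary, possibly infinite) and payoff functions $p_i:H_1\times\cdots\times H_n\to\mathbb{R}$. A restriction of $H$ is a tuple $G=(G_1,\ldots,G_n)$ with $G_i\subseteq H_i$, ordered by componentwise inclusion; $(H_1,\ldots,H_n)$ is identified with $H$. A property $\phi_i$ is a relation $\phi_i(s_i,G)$ between strategies $s_i\in H_i$ and restrictions $G$ of $H$ (no monotonicity is assumed). The operator $T_{\overline{\phi}}$ on restrictions is $T_{\overline{\phi}}(G)=(G_1',\ldots,G_n')$ with $G_i'=\{s_i\in G_i\mid \phi_i(s_i,G)\}$. Put $T^0=H$, $T^{\alpha+1}=T(T^\alpha)$, $T^\beta=\bigcap_{\alpha<\beta}T^\alpha$ for limit $\beta$; $T^\infty:=T^{\alpha}$ for the least $\alpha$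 with $T^{\alpha+1}=T^\alpha$. The standard knowledge model for a restriction $G$ is $(\Omega,\overline{s_1},\ldots,\overline{s_n},P_1,\ldots,P_n)$ with $\Omega=G_1\times\cdots\times G_n$ (empty if some $G_i$ is empty), $\overline{s_i}(\omega)=\omega_i$, and $P_i(\omega)=\{\omega'\in\Omega\mid\overline{s_i}(\omega')=\overline{s_i}(\omega)\}$. Functions are identified with their graphs. For a model $\mathcal{M}=(\Omega,\overline{s_1},\ldots,\overline{s_n},P_1,\ldots,P_n)$ and $E\subseteq\Omega$ put $G_E:=(\overline{s_1}(E),\ldots,\overline{s_n}(E))$. The event that player $i$ is $\phi_i$-rational in $\mathcal{M}$ is $\langle\phi_i\rangle:=\{\omega\in\Omega\mid\phi_i(\overline{s_i}(\omega),G_{P_i(\omega)})\}$, and $\langle\overline{\phi}\rangle:=(\langle\phi_1\rangle,\ldots,\langle\phi_n\rangle)$. The effect of public announcements $\overline{E}=(E_1,\ldots,E_n)$ (events in $\mathcal{M}$) on $\mathcal{M}$ is the model $[\overline{E}](\mathcal{M})$ with state set $E:=\bigcap_iE_i$, with functions $\overline{s_i}$ restricted to $E$, and with correspondences $\omega\mapsto P_i(\omega)\cap E$ for $\omega\in E$. Iterated effect: $\mathcal{M}_0$ is the standard knowledge model for $H$; $\mathcal{M}_{\alpha+1}=[\langle\overline{\phi}\rangle](\mathcal{M}_\alpha)$ with $\langle\overline{\phi}\rangle$ computed in $\mathcal{M}_\alpha$; for limit $\beta$, $\mathcal{M}_\beta$ is the model whose state set $E$ is the intersection of the state sets of the $\mathcal{M}_\alpha$,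 $\alpha<\beta$, whose functions are the functions $\overline{s_i}$ of $\mathcal{M}_0$ restricted to $E$, and whose correspondences are $\omega\mapsto P_i(\omega)\cap E$ for $\omega\in E$, where the $P_i$ are the correspondences of $\mathcal{M}_0$. $\langle\overline{\phi}\rangle^\infty:=\mathcal{M}_\alpha$ for the least $\alpha$ with $\mathcal{M}_{\alpha+1}=\mathcal{M}_\alpha$. *)

theory Defs
  imports Complex_Main "HOL-Library.FuncSet" "HOL-Library.Cardinality" "HOL-Library.Countable_Set"
begin

section \<open>Ordinals and transfinite iteration\<close>

text \<open>
  There is no HOL type of all ordinals. The type \<open>'a ordinal\<close> consists of the ordinals below the
  successor cardinal of the infinite cardinal \<open>|nat \<times> 'a|\<close>. The lemmas \<open>ex_T_iter_stable\<close> and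
  \<open>ex_model_iter_stable\<close> below show that, for \<open>'a\<close> the type of strategy profiles, both iterations
  of interest become constant within this range, so that the least ordinal at which they do so
  exists and is not affected by the omission of larger ordinals.
\<close>

abbreviation ordinal_rel :: "(nat \<times> 'a) set rel" where
  "ordinal_rel \<equiv> cardSuc (card_of (UNIV :: (nat \<times> 'a) set))"

lemma ordinal_rel_Card_order: "Card_order (ordinal_rel :: (nat \<times> 'a) set rel)"
  by (rule cardSuc_Card_order[OF card_of_Card_order])

lemma ordinal_rel_Well_order: "Well_order (ordinal_rel :: (nat \<times> 'a) set rel)"
  using ordinal_rel_Card_order card_order_on_well_order_on by blast

lemma infinite_Field_ordinal_rel: "infinite (Field (ordinal_rel :: (nat \<times> 'a) set rel))"
  by (simp add: card_of_cardSuc_finite finite_prod)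

typedef 'a ordinal = "Field (ordinal_rel :: (nat \<times> 'a) set rel)"
  using infinite_Field_ordinal_rel by (metis finite.emptyI ex_in_conv)

instantiation ordinal :: (type) wellorder
begin

definition less_eq_ordinal :: "'a ordinal \<Rightarrow> 'a ordinal \<Rightarrow> bool" where
  "\<alpha> \<le> \<beta> \<longleftrightarrow> (Rep_ordinal \<alpha>, Rep_ordinal \<beta>) \<in> ordinal_rel"

definition less_ordinal :: "'a ordinal \<Rightarrow> 'a ordinal \<Rightarrow> bool" where
  "\<alpha> < \<beta> \<longleftrightarrow> \<alpha> \<le> \<beta> \<and> \<alpha> \<noteq> (\<beta> :: 'a ordinal)"

instance
proof
  interpret wo_rel "ordinal_rel :: (nat \<times> 'a) set rel"
    using ordinal_rel_Well_order by (simp add: wo_rel_def)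
  fix \<alpha> \<beta> \<gamma> :: "'a ordinal"
  show refl: "\<alpha> \<le> \<alpha>"
    using REFL Rep_ordinal[of \<alpha>] by (simp add: less_eq_ordinal_def refl_on_def)
  show trans: "\<alpha> \<le> \<beta> \<Longrightarrow> \<beta> \<le> \<gamma> \<Longrightarrow> \<alpha> \<le> \<gamma>"
    using TRANS unfolding less_eq_ordinal_def trans_def by blast
  show antisym: "\<alpha> \<le> \<beta> \<Longrightarrow> \<beta> \<le> \<alpha> \<Longrightarrow> \<alpha> = \<beta>"
    using ANTISYM Rep_ordinal_inject[of \<alpha> \<beta>] unfolding less_eq_ordinal_def antisym_def by blast
  show "\<alpha> < \<beta> \<longleftrightarrow> \<alpha> \<le> \<beta> \<and> \<not> \<beta> \<le> \<alpha>"
    using refl antisym unfolding less_ordinal_def by blast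
  show "\<alpha> \<le> \<beta> \<or> \<beta> \<le> \<alpha>"
    using TOTALS Rep_ordinal[of \<alpha>] Rep_ordinal[of \<beta>] unfolding less_eq_ordinal_def by blast
next
  fix P :: "'a ordinal \<Rightarrow> bool" and \<alpha>
  assume step: "\<And>\<beta>. (\<And>\<gamma>. \<gamma> < \<beta> \<Longrightarrow> P \<gamma>) \<Longrightarrow> P \<beta>"
  interpret wo_rel "ordinal_rel :: (nat \<times> 'a) set rel"
    using ordinal_rel_Well_order by (simp add: wo_rel_def)
  have "wf (inv_image (ordinal_rel - Id) (Rep_ordinal :: 'a ordinal \<Rightarrow> _))"
    using WF by (rule wf_inv_image)
  moreover have "inv_image (ordinal_rel - Id) (Rep_ordinal :: 'a ordinal \<Rightarrow> _) = {(\<gamma>, \<beta>). \<gamma> < \<beta>}"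
    by (auto simp: inv_image_def less_ordinal_def less_eq_ordinal_def Rep_ordinal_inject)
  ultimately show "P \<alpha>"
    using step by (induction \<alpha> rule: wf_induct_rule) auto
qed

end

lemma ordinal_no_max: "\<exists>\<beta>. (\<alpha> :: 'a ordinal) < \<beta>"
proof -
  have "\<exists>b \<in> Field (ordinal_rel :: (nat \<times> 'a) set rel).
      Rep_ordinal \<alpha> \<noteq> b \<and> (Rep_ordinal \<alpha>, b) \<in> ordinal_rel"
    using infinite_Card_order_limit[OF ordinal_rel_Card_order infinite_Field_ordinal_rel Rep_ordinal]
    by blast
  then show ?thesis
    by (metis Rep_ordinal_cases less_eq_ordinal_def less_ordinal_def)
qed

definition osucc :: "'o :: wellorder \<Rightarrow> 'o" where
  "osucc \<alpha> = (LEAST \<beta>. \<alpha> < \<beta>)"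

lemma osucc_greater: "(\<alpha> :: 'a ordinal) < osucc \<alpha>"
  unfolding osucc_def using ordinal_no_max by (rule LeastI_ex)

lemma osucc_le: "\<alpha> < \<beta> \<Longrightarrow> osucc \<alpha> \<le> \<beta>"
  unfolding osucc_def by (rule Least_le)

lemma osucc_inject: "osucc \<alpha> = osucc \<beta> \<Longrightarrow> \<alpha> = (\<beta> :: 'a ordinal)"
  by (metis leD linorder_neqE osucc_greater osucc_le)

text \<open>
  \<open>transfinite_iter F L x \<alpha>\<close> starts with \<open>x\<close>, applies \<open>F\<close> at successors, and at limits applies \<open>L\<close>
  to the set of all earlier iterates. The condition \<open>\<beta> < \<alpha>\<close> matters only for well-orders
  with a largest element.
\<close>

function transfinite_iter ::
  "('x \<Rightarrow> 'x) \<Rightarrow> ('x set \<Rightarrow> 'x) \<Rightarrow> 'x \<Rightarrow> 'o :: wellorder \<Rightarrow> 'x"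
where
  "transfinite_iter F L x \<alpha> =
    (if \<forall>\<beta>. \<alpha> \<le> \<beta> then x
     else if \<exists>\<beta><\<alpha>. \<alpha> = osucc \<beta>
       then F (transfinite_iter F L x (SOME \<beta>. \<beta> < \<alpha> \<and> \<alpha> = osucc \<beta>))
     else L (transfinite_iter F L x ` {..<\<alpha>}))"
  by pat_completeness auto
termination
proof (relation "inv_image {(\<beta>, \<alpha>). \<beta> < \<alpha>} (\<lambda>(F, L, x, \<alpha>). \<alpha>)", goal_cases)
  case 1
  show ?case
    by (rule wf_inv_image[OF wf])
next
  case (2 F L x \<alpha>)
  then have "\<exists>\<beta>. \<beta> < \<alpha> \<and> \<alpha> = osucc \<beta>"
    by blast
  then show ?case
    using someI_ex[of "\<lambda>\<beta>. \<beta> < \<alpha> \<and> \<alpha> = osucc \<beta>"] by simp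
qed auto

declare transfinite_iter.simps [simp del]

lemma transfinite_iter_zero: "(\<And>\<beta>. \<alpha> \<le> \<beta>) \<Longrightarrow> transfinite_iter F L x \<alpha> = x"
  by (subst transfinite_iter.simps) auto

lemma transfinite_iter_osucc:
  fixes \<alpha> :: "'a ordinal"
  shows "transfinite_iter F L x (osucc \<alpha>) = F (transfinite_iter F L x \<alpha>)"
proof -
  have "\<not> (\<forall>\<beta>. osucc \<alpha> \<le> \<beta>)"
    using osucc_greater by (metis leD)
  moreover have "(SOME \<beta>. \<beta> < osucc \<alpha> \<and> osucc \<alpha> = osucc \<beta>) = \<alpha>"
    using osucc_greater by (intro some_equality) (auto dest: osucc_inject)
  ultimately show ?thesis
    using osucc_greater by (subst transfinite_iter.simps) auto
qed

lemma transfinite_iter_limit: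
  fixes \<alpha> :: "'a ordinal"
  assumes "\<beta> < \<alpha>" and "\<And>\<gamma>. \<gamma> < \<alpha> \<Longrightarrow> osucc \<gamma> \<noteq> \<alpha>"
  shows "transfinite_iter F L x \<alpha> = L (transfinite_iter F L x ` {..<\<alpha>})"
proof -
  have "\<not> (\<forall>\<beta>. \<alpha> \<le> \<beta>)" and "\<not> (\<exists>\<gamma><\<alpha>. \<alpha> = osucc \<gamma>)"
    using assms by (auto simp: not_le)
  then show ?thesis
    by (subst transfinite_iter.simps) (simp only: if_False)
qed

lemma ordinal_cases:
  fixes \<alpha> :: "'a ordinal"
  obtains "\<And>\<beta>. \<alpha> \<le> \<beta>" | \<beta> where "\<alpha> = osucc \<beta>"
    | \<beta> where "\<beta> < \<alpha>" and "\<And>\<gamma>. \<gamma> < \<alpha> \<Longrightarrow> osucc \<gamma> \<noteq> \<alpha>"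
  by (metis not_le)

lemma transfinite_iter_antimono:
  fixes m :: "'x \<Rightarrow> 'b set" and \<alpha> \<beta> :: "'a ordinal"
  assumes F: "\<And>y. m (F y) \<subseteq> m y" and L: "\<And>Y y. y \<in> Y \<Longrightarrow> m (L Y) \<subseteq> m y"
  shows "\<alpha> \<le> \<beta> \<Longrightarrow> m (transfinite_iter F L x \<beta>) \<subseteq> m (transfinite_iter F L x \<alpha>)"
proof (induction \<beta> rule: less_induct)
  case (less \<beta>)
  consider "\<alpha> = \<beta>" | "\<alpha> < \<beta>"
    using less.prems by fastforce
  then show ?case
  proof cases
    case 2
    show ?thesis
    proof (cases \<beta> rule: ordinal_cases)
      case 1
      then show ?thesis using 2 leD by blast
    next
      case (2 \<gamma>)
      with \<open>\<alpha> < \<beta>\<close> have "\<alpha> \<le> \<gamma>"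
        by (metis leD leI osucc_le)
      then show ?thesis
        using less.IH[of \<gamma>] F osucc_greater unfolding 2 transfinite_iter_osucc by blast
    next
      case (3 \<gamma>)
      then show ?thesis
        using L \<open>\<alpha> < \<beta>\<close> by (simp add: transfinite_iter_limit)
    qed
  qed simp
qed

lemma ex_stable:
  fixes f :: "'a ordinal \<Rightarrow> 'b set" and g :: "'b \<Rightarrow> nat \<times> 'a"
  assumes f: "\<And>\<alpha> \<beta>. \<alpha> \<le> \<beta> \<Longrightarrow> f \<beta> \<subseteq> f \<alpha>" and g: "inj g"
  shows "\<exists>\<alpha>. f (osucc \<alpha>) = f \<alpha>"
proof (rule ccontr)
  assume "\<not> ?thesis"
  then have "\<exists>b. b \<in> f \<alpha> \<and> b \<notin> f (osucc \<alpha>)" for \<alpha>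
    using f[of \<alpha> "osucc \<alpha>"] osucc_greater[of \<alpha>] by (metis less_imp_le subsetI subset_antisym)
  then obtain e where e: "\<And>\<alpha>. e \<alpha> \<in> f \<alpha> \<and> e \<alpha> \<notin> f (osucc \<alpha>)"
    by metis
  have "e \<alpha> \<noteq> e \<beta>" if "\<alpha> < \<beta>" for \<alpha> \<beta>
    using f[OF osucc_le[OF that]] e[of \<alpha>] e[of \<beta>] by auto
  then have "inj e"
    by (metis injI linorder_neqE)
  let ?r = "ordinal_rel :: (nat \<times> 'a) set rel"
  have "inj_on (\<lambda>x. g (e (Abs_ordinal x))) (Field ?r)"
  proof (rule inj_onI)
    fix x y
    assume "x \<in> Field ?r" and "y \<in> Field ?r" and "g (e (Abs_ordinal x)) = g (e (Abs_ordinal y))"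
    then show "x = y"
      using g \<open>inj e\<close> Abs_ordinal_inject[of x y] by (simp add: inj_eq)
  qed
  then have "(card_of (Field ?r), card_of (UNIV :: (nat \<times> 'a) set)) \<in> ordLeq"
    using card_of_ordLeq[of "Field ?r" "UNIV :: (nat \<times> 'a) set"] by blast
  then have "(?r, card_of (UNIV :: (nat \<times> 'a) set)) \<in> ordLeq"
    using ordIso_ordLeq_trans[OF ordIso_symmetric[OF card_of_Field_ordIso[OF ordinal_rel_Card_order]]]
    by blast
  then show False
    using cardSuc_greater[OF card_of_Card_order] not_ordLess_ordLeq by blast
qed


section \<open>Games, restrictions and elimination\<close>

text \<open>
  Players form a finite type and all strategy sets lie in one type \<open>'s\<close>. The payoffs are only
  meaningful on profiles in \<open>Pi UNIV (strategies H)\<close>.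
\<close>

record ('i, 's) game =
  strategies :: "'i \<Rightarrow> 's set"
  payoff :: "'i \<Rightarrow> ('i \<Rightarrow> 's) \<Rightarrow> real"

definition strategic_game :: "('i :: finite, 's) game \<Rightarrow> bool" where
  "strategic_game H \<longleftrightarrow> CARD('i) > 1 \<and> (\<forall>i. strategies H i \<noteq> {})"

definition is_restriction :: "('i \<Rightarrow> 's set) \<Rightarrow> ('i, 's) game \<Rightarrow> bool" where
  "is_restriction G H \<longleftrightarrow> (\<forall>i. G i \<subseteq> strategies H i)"

type_synonym ('i, 's) property = "'s \<Rightarrow> ('i \<Rightarrow> 's set) \<Rightarrow> bool"

definition condition_A :: "('i, 's) game \<Rightarrow> 'i \<Rightarrow> ('i, 's) property \<Rightarrow> bool" where
  "condition_A H i \<phi> \<longleftrightarrow>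
    (\<forall>G G'. is_restriction G H \<and> is_restriction G' H \<and> (\<forall>j. j \<noteq> i \<longrightarrow> G j = G' j) \<longrightarrow>
      (\<forall>s \<in> strategies H i. \<phi> s G \<longleftrightarrow> \<phi> s G'))"

definition T_op :: "('i \<Rightarrow> ('i, 's) property) \<Rightarrow> ('i \<Rightarrow> 's set) \<Rightarrow> ('i \<Rightarrow> 's set)" where
  "T_op \<phi> G = (\<lambda>i. {s \<in> G i. \<phi> i s G})"

definition T_iter ::
  "('i \<Rightarrow> ('i, 's) property) \<Rightarrow> ('i, 's) game \<Rightarrow> ('i \<Rightarrow> 's) ordinal \<Rightarrow> ('i \<Rightarrow> 's set)"
where
  "T_iter \<phi> H = transfinite_iter (T_op \<phi>) (\<lambda>\<G> i. \<Inter>G\<in>\<G>. G i) (strategies H)"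

definition T_infinity :: "('i \<Rightarrow> ('i, 's) property) \<Rightarrow> ('i, 's) game \<Rightarrow> ('i \<Rightarrow> 's set)" where
  "T_infinity \<phi> H = T_iter \<phi> H (LEAST \<alpha>. T_iter \<phi> H (osucc \<alpha>) = T_iter \<phi> H \<alpha>)"

lemma ex_T_iter_stable:
  fixes \<phi> :: "'i :: finite \<Rightarrow> ('i, 's) property"
  shows "\<exists>\<alpha>. T_iter \<phi> H (osucc \<alpha>) = T_iter \<phi> H \<alpha>"
proof -
  have "inj (\<lambda>(i :: 'i, s :: 's). (to_nat_on UNIV i, \<lambda>_ :: 'i. s))"
    using inj_on_to_nat_on[of "UNIV :: 'i set"]
    by (auto simp: inj_on_def countable_finite dest: fun_cong)
  moreover have "Sigma UNIV (T_iter \<phi> H \<beta>) \<subseteq> Sigma UNIV (T_iter \<phi> H \<alpha>)" if "\<alpha> \<le> \<beta>" for \<alpha> \<beta>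
    unfolding T_iter_def using that
    by (intro transfinite_iter_antimono[where m = "Sigma UNIV"]) (auto simp: T_op_def)
  ultimately obtain \<alpha> where "Sigma UNIV (T_iter \<phi> H (osucc \<alpha>)) = Sigma UNIV (T_iter \<phi> H \<alpha>)"
    using ex_stable[of "\<lambda>\<alpha>. Sigma UNIV (T_iter \<phi> H \<alpha>)"] by blast
  then have "T_iter \<phi> H (osucc \<alpha>) = T_iter \<phi> H \<alpha>"
    by (intro ext) (auto simp: set_eq_iff)
  then show ?thesis ..
qed


section \<open>Knowledge models and public announcements\<close>

text \<open>
  The functions of a model are identified with their graphs, hence represented by functions that
  are \<open>undefined\<close> outside the state set. Equality of models is thus equality of state sets and
  equality of all functions and correspondences on the states.
\<close>

record ('w, 'i, 's) model =
  states :: "'w set"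
  strat :: "'i \<Rightarrow> 'w \<Rightarrow> 's"
  corr :: "'i \<Rightarrow> 'w \<Rightarrow> 'w set"

definition standard_model :: "('i \<Rightarrow> 's set) \<Rightarrow> ('i \<Rightarrow> 's, 'i, 's) model" where
  "standard_model G =
    \<lparr> states = Pi UNIV G,
      strat = (\<lambda>i. \<lambda>\<omega>\<in>Pi UNIV G. \<omega> i),
      corr = (\<lambda>i. \<lambda>\<omega>\<in>Pi UNIV G. {\<omega>' \<in> Pi UNIV G. \<omega>' i = \<omega> i}) \<rparr>"

definition restrict_model :: "('w, 'i, 's) model \<Rightarrow> 'w set \<Rightarrow> ('w, 'i, 's) model" where
  "restrict_model M E =
    \<lparr> states = E,
      strat = (\<lambda>i. \<lambda>\<omega>\<in>E. strat M i \<omega>),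
      corr = (\<lambda>i. \<lambda>\<omega>\<in>E. corr M i \<omega> \<inter> E) \<rparr>"

definition induced_restriction :: "('w, 'i, 's) model \<Rightarrow> 'w set \<Rightarrow> ('i \<Rightarrow> 's set)" where
  "induced_restriction M E = (\<lambda>i. strat M i ` E)"

definition rational :: "('i \<Rightarrow> ('i, 's) property) \<Rightarrow> ('w, 'i, 's) model \<Rightarrow> 'i \<Rightarrow> 'w set" where
  "rational \<phi> M i =
    {\<omega> \<in> states M. \<phi> i (strat M i \<omega>) (induced_restriction M (corr M i \<omega>))}"

definition announce :: "('i \<Rightarrow> 'w set) \<Rightarrow> ('w, 'i, 's) model \<Rightarrow> ('w, 'i, 's) model" where
  "announce E M = restrict_model M (\<Inter>i. E i)"

definition model_iter ::
  "('i \<Rightarrow> ('i, 's) property) \<Rightarrow> ('i, 's) game \<Rightarrow> ('i \<Rightarrow> 's) ordinal \<Rightarrow> ('i \<Rightarrow> 's, 'i, 's) model"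
where
  "model_iter \<phi> H =
    transfinite_iter
      (\<lambda>M. announce (rational \<phi> M) M)
      (\<lambda>\<M>. restrict_model (standard_model (strategies H)) (\<Inter>M\<in>\<M>. states M))
      (standard_model (strategies H))"

definition rationality_announcements_infinity ::
  "('i \<Rightarrow> ('i, 's) property) \<Rightarrow> ('i, 's) game \<Rightarrow> ('i \<Rightarrow> 's, 'i, 's) model"
where
  "rationality_announcements_infinity \<phi> H =
    model_iter \<phi> H (LEAST \<alpha>. model_iter \<phi> H (osucc \<alpha>) = model_iter \<phi> H \<alpha>)"

lemma restrict_model_twice:
  "E' \<subseteq> E \<Longrightarrow> restrict_model (restrict_model M E) E' = restrict_model M E'"
  by (auto simp: restrict_model_def fun_eq_iff restrict_def)

lemma model_iter_eq_restrict_model: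
  "model_iter \<phi> H \<alpha> = restrict_model (standard_model (strategies H)) (states (model_iter \<phi> H \<alpha>))"
proof (induction \<alpha> rule: less_induct)
  case (less \<alpha>)
  show ?case
  proof (cases \<alpha> rule: ordinal_cases)
    case 1
    then show ?thesis
      by (auto simp: model_iter_def transfinite_iter_zero restrict_model_def standard_model_def
          fun_eq_iff restrict_def)
  next
    case (2 \<beta>)
    let ?M = "model_iter \<phi> H \<beta>" and ?E = "\<Inter>i. rational \<phi> (model_iter \<phi> H \<beta>) i"
    have *: "model_iter \<phi> H \<alpha> = restrict_model ?M ?E"
      by (simp add: 2 model_iter_def transfinite_iter_osucc announce_def)
    have "?E \<subseteq> states ?M"
      by (auto simp: rational_def)
    then have "restrict_model ?M ?E = restrict_model (standard_model (strategies H)) ?E"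
      using less.IH[of \<beta>] osucc_greater[of \<beta>] restrict_model_twice unfolding 2 by metis
    then show ?thesis
      unfolding * by (simp add: restrict_model_def)
  next
    case (3 \<beta>)
    then show ?thesis
      by (simp add: model_iter_def transfinite_iter_limit restrict_model_def)
  qed
qed

lemma ex_model_iter_stable: "\<exists>\<alpha>. model_iter \<phi> H (osucc \<alpha>) = model_iter \<phi> H \<alpha>"
proof -
  have "states (model_iter \<phi> H \<beta>) \<subseteq> states (model_iter \<phi> H \<alpha>)" if "\<alpha> \<le> \<beta>" for \<alpha> \<beta>
    unfolding model_iter_def using that
    by (intro transfinite_iter_antimono[where m = states])
      (auto simp: announce_def restrict_model_def rational_def)
  moreover have "inj (\<lambda>\<omega> :: 'a \<Rightarrow> 'b. (0 :: nat, \<omega>))"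
    by (simp add: inj_on_def)
  ultimately obtain \<alpha> where "states (model_iter \<phi> H (osucc \<alpha>)) = states (model_iter \<phi> H \<alpha>)"
    using ex_stable[of "\<lambda>\<alpha>. states (model_iter \<phi> H \<alpha>)"] by blast
  then have "model_iter \<phi> H (osucc \<alpha>) = model_iter \<phi> H \<alpha>"
    by (metis model_iter_eq_restrict_model)
  then show ?thesis ..
qed

end

(* At every stage the announced model is the standard model of the corresponding stage of T. In a
   state \<omega> of the standard model of a restriction G, player i knows exactly his own strategy, so
   G_{P_i(\<omega>)} is G with its i-th component replaced by {\<omega>_i}; by condition (A) the properties
   cannot tell the two apart. If some component of G is empty, there are no states, while T may go on
   eliminating strategies; so the two iterations may stop at different ordinals, but the limits
   agree because a stable iteration of announcements remains constant. *)

theory Submission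
  imports Defs
begin

text \<open>Intersecting a cell of the larger product with \<open>Pi UNIV G\<close> gives the cell
  of the smaller one, and both sides are \<open>undefined\<close> elsewhere.\<close>

lemma restrict_standard_model:
  assumes "\<And>i. G i \<subseteq> G' i"
  shows "restrict_model (standard_model G') (Pi UNIV G) = standard_model G"
proof -
  have "Pi UNIV G \<subseteq> Pi UNIV G'"
    using assms by (intro Pi_mono) auto
  then show ?thesis
    by (auto simp: restrict_model_def standard_model_def fun_eq_iff restrict_def)
qed

lemma states_standard_model: "states (standard_model G) = Pi UNIV G"
  by (simp add: standard_model_def)

lemma states_restrict_model: "states (restrict_model M E) = E"
  by (simp add: restrict_model_def)

text \<open>Coordinates of a product vary independently, so fixing the i-th leaves every other free.
  The profile \<omega> matters: if the product were empty, so would be the image, even where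
  \<open>G j\<close> is not.\<close>

lemma image_component_Pi_fixed:
  assumes "\<omega> \<in> Pi UNIV G"
  shows "(\<lambda>\<omega>'. \<omega>' j) ` {\<omega>' \<in> Pi UNIV G. \<omega>' i = \<omega> i} = (if j = i then {\<omega> i} else G j)"
proof (cases "j = i")
  case False
  have "s \<in> (\<lambda>\<omega>'. \<omega>' j) ` {\<omega>' \<in> Pi UNIV G. \<omega>' i = \<omega> i}" if "s \<in> G j" for s
    \<comment> \<open>Changing \<omega> at \<open>j\<close> alone keeps the i-th coordinate
      fixed.\<close>
    using that assms False by (intro image_eqI[where x = "\<omega>(j := s)"]) auto
  then show ?thesis
    using False by auto
qed (use assms in auto)

lemma induced_restriction_standard_model:
  assumes "\<omega> \<in> Pi UNIV G"
  shows "induced_restriction (standard_model G) (corr (standard_model G) i \<omega>) = G(i := {\<omega> i})"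
proof
  fix j
  have "induced_restriction (standard_model G) (corr (standard_model G) i \<omega>) j =
      (\<lambda>\<omega>'. \<omega>' j) ` {\<omega>' \<in> Pi UNIV G. \<omega>' i = \<omega> i}"
    using assms by (auto simp: induced_restriction_def standard_model_def intro!: image_cong)
  then show "induced_restriction (standard_model G) (corr (standard_model G) i \<omega>) j = (G(i := {\<omega> i})) j"
    using image_component_Pi_fixed[OF assms, of j i] by simp
qed

text \<open>The restriction that player \<open>i\<close> considers,
  \<open>G(i := {\<omega> i})\<close>, differs from \<open>G\<close> only at \<open>i\<close>, which
  is just what condition (A) ignores.\<close>

lemma rational_standard_model:
  assumes "condition_A H i (\<phi> i)" and "is_restriction G H"
  shows "rational \<phi> (standard_model G) i = {\<omega> \<in> Pi UNIV G. \<phi> i (\<omega> i) G}"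
proof -
  have "\<phi> i (\<omega> i) (G(i := {\<omega> i})) \<longleftrightarrow> \<phi> i (\<omega> i) G" if "\<omega> \<in> Pi UNIV G" for \<omega>
  proof -
    have "\<omega> i \<in> strategies H i"
      using that assms(2) by (auto simp: is_restriction_def)
    then have "is_restriction (G(i := {\<omega> i})) H"
      using assms(2) by (auto simp: is_restriction_def)
    with \<open>\<omega> i \<in> strategies H i\<close> show ?thesis
      using assms unfolding condition_A_def by (metis fun_upd_other)
  qed
  moreover have "strat (standard_model G) i \<omega> = \<omega> i" if "\<omega> \<in> Pi UNIV G" for \<omega>
    using that by (simp add: standard_model_def)
  ultimately show ?thesis
    unfolding rational_def
    by (auto simp: states_standard_model induced_restriction_standard_model)
qed

lemma announce_rational_standard_model:
  assumes "\<And>i. condition_A H i (\<phi> i)" and "is_restriction G H"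
  shows "announce (rational \<phi> (standard_model G)) (standard_model G) = standard_model (T_op \<phi> G)"
proof -
  \<comment> \<open>Each event constrains a single coordinate, so their intersection is again a
    product.\<close>
  have "(\<Inter>i. rational \<phi> (standard_model G) i) = Pi UNIV (T_op \<phi> G)"
    using rational_standard_model[where \<phi> = \<phi>, OF assms] by (auto simp: T_op_def Pi_iff)
  then show ?thesis
    by (simp add: announce_def restrict_standard_model T_op_def)
qed

lemma T_iter_antimono:
  assumes "\<alpha> \<le> \<beta>"
  shows "T_iter \<phi> H \<beta> i \<subseteq> T_iter \<phi> H \<alpha> i"
  using assms unfolding T_iter_def
  by (intro transfinite_iter_antimono[where m = "\<lambda>G. G i"]) (auto simp: T_op_def)

text \<open>Makes condition (A) available at every stage: the iteration starts at
  \<open>strategies H\<close> and only shrinks.\<close>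

lemma T_iter_is_restriction: "is_restriction (T_iter \<phi> H \<alpha>) H"
proof -
  \<comment> \<open>\<zeta> is the ordinal zero.\<close>
  define \<zeta> where "\<zeta> = (LEAST \<beta> :: ('a \<Rightarrow> 'b) ordinal. True)"
  have "\<zeta> \<le> \<beta>" for \<beta>
    unfolding \<zeta>_def by (rule Least_le) simp
  then have "T_iter \<phi> H \<zeta> = strategies H" and "\<zeta> \<le> \<alpha>"
    by (simp_all add: T_iter_def transfinite_iter_zero)
  then show ?thesis
    using T_iter_antimono[of \<zeta> \<alpha> \<phi> H] by (simp add: is_restriction_def)
qed

lemma model_iter_eq_standard_model:
  assumes "\<And>i. condition_A H i (\<phi> i)"
  shows "model_iter \<phi> H \<alpha> = standard_model (T_iter \<phi> H \<alpha>)"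
proof (induction \<alpha> rule: less_induct)
  case (less \<alpha>)
  show ?case
  proof (cases \<alpha> rule: ordinal_cases)
    case 1
    then show ?thesis
      by (simp add: model_iter_def T_iter_def transfinite_iter_zero)
  next
    case (2 \<beta>)
    have "model_iter \<phi> H \<alpha> = announce (rational \<phi> (model_iter \<phi> H \<beta>)) (model_iter \<phi> H \<beta>)"
      by (simp add: 2 model_iter_def transfinite_iter_osucc)
    also have "\<dots> = standard_model (T_op \<phi> (T_iter \<phi> H \<beta>))"
      using less.IH[of \<beta>] osucc_greater[of \<beta>]
        announce_rational_standard_model[OF assms T_iter_is_restriction]
      unfolding 2 by simp
    finally show ?thesis
      by (simp add: 2 T_iter_def transfinite_iter_osucc)
  next
    case (3 \<beta>)
    have T: "T_iter \<phi> H \<alpha> = (\<lambda>i. \<Inter>\<gamma>\<in>{..<\<alpha>}. T_iter \<phi> H \<gamma> i)"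
      using 3 by (simp add: T_iter_def transfinite_iter_limit image_image)
    have "model_iter \<phi> H \<alpha> =
        restrict_model (standard_model (strategies H)) (\<Inter>\<gamma>\<in>{..<\<alpha>}. states (model_iter \<phi> H \<gamma>))"
      using 3 by (simp add: model_iter_def transfinite_iter_limit image_image)
    \<comment> \<open>An intersection of products is the product of the intersections, also when
      components become empty.\<close>
    also have "(\<Inter>\<gamma>\<in>{..<\<alpha>}. states (model_iter \<phi> H \<gamma>)) = Pi UNIV (T_iter \<phi> H \<alpha>)"
      using less.IH by (auto simp: T states_standard_model Pi_iff)
    also have "restrict_model (standard_model (strategies H)) \<dots> = standard_model (T_iter \<phi> H \<alpha>)"
      using T_iter_is_restriction[of \<phi> H \<alpha>]
      by (intro restrict_standard_model) (simp add: is_restriction_def)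
    finally show ?thesis .
  qed
qed

lemma model_iter_antimono:
  assumes "\<alpha> \<le> \<beta>"
  shows "states (model_iter \<phi> H \<beta>) \<subseteq> states (model_iter \<phi> H \<alpha>)"
  using assms unfolding model_iter_def
  by (intro transfinite_iter_antimono[where m = states])
    (auto simp: announce_def restrict_model_def rational_def)

text \<open>Limits need an argument, since they are formed from the initial model and all earlier
  stages, including those before \<alpha>.\<close>

lemma model_iter_constant_of_stable:
  assumes stable: "model_iter \<phi> H (osucc \<alpha>) = model_iter \<phi> H \<alpha>"
  shows "\<alpha> \<le> \<beta> \<Longrightarrow> model_iter \<phi> H \<beta> = model_iter \<phi> H \<alpha>"
proof (induction \<beta> rule: less_induct)
  case (less \<beta>)
  show ?case
  proof (cases \<beta> rule: ordinal_cases)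
    case 1
    with less.prems show ?thesis
      by (metis antisym)
  next
    case (2 \<gamma>)
    show ?thesis
    proof (cases "\<alpha> = \<beta>")
      case False
      with less.prems 2 have "\<alpha> \<le> \<gamma>"
        by (metis leD leI osucc_le order.antisym)
      then have "model_iter \<phi> H \<gamma> = model_iter \<phi> H \<alpha>"
        using less.IH 2 osucc_greater by blast
      then show ?thesis
        using stable by (simp add: 2 model_iter_def transfinite_iter_osucc)
    qed simp
  next
    case (3 \<gamma>)
    \<comment> \<open>Stages from \<alpha> on equal the stable one by induction, and those before it
      contain it, so the intersection cannot fall below it.\<close>
    have "states (model_iter \<phi> H \<alpha>) \<subseteq> states (model_iter \<phi> H \<delta>)" if "\<delta> < \<beta>" for \<delta>
      using less.IH[OF that] model_iter_antimono[of \<delta> \<alpha> \<phi> H] by (cases "\<alpha> \<le> \<delta>") auto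
    moreover have "states (model_iter \<phi> H \<beta>) = (\<Inter>\<delta>\<in>{..<\<beta>}. states (model_iter \<phi> H \<delta>))"
      using 3 by (simp add: model_iter_def transfinite_iter_limit states_restrict_model image_image)
    ultimately have "states (model_iter \<phi> H \<beta>) = states (model_iter \<phi> H \<alpha>)"
      using model_iter_antimono[OF less.prems, of \<phi> H] by blast
    \<comment> \<open>Every stage is determined by its state set.\<close>
    then show ?thesis
      by (metis model_iter_eq_restrict_model)
  qed
qed

theorem theorem6:
  fixes H :: "('i :: finite, 's) game"
    and \<phi> :: "'i \<Rightarrow> ('i, 's) property"
  assumes "strategic_game H"
    and "\<And>i. condition_A H i (\<phi> i)"
  shows "rationality_announcements_infinity \<phi> H = standard_model (T_infinity \<phi> H)"
proof -
  define \<alpha> where "\<alpha> = (LEAST \<alpha>. model_iter \<phi> H (osucc \<alpha>) = model_iter \<phi> H \<alpha>)"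
  define \<beta> where "\<beta> = (LEAST \<beta>. T_iter \<phi> H (osucc \<beta>) = T_iter \<phi> H \<beta>)"
  note model = model_iter_eq_standard_model[of H \<phi>, OF assms(2)]
  have "model_iter \<phi> H (osucc \<alpha>) = model_iter \<phi> H \<alpha>"
    unfolding \<alpha>_def using ex_model_iter_stable by (rule LeastI_ex)
  moreover have "T_iter \<phi> H (osucc \<beta>) = T_iter \<phi> H \<beta>"
    unfolding \<beta>_def using ex_T_iter_stable by (rule LeastI_ex)
  \<comment> \<open>Stability of \<open>T_iter\<close> passes to the models; the converse can fail,
    as \<open>standard_model\<close> identifies all restrictions with an empty component.\<close>
  then have "\<alpha> \<le> \<beta>"
    unfolding \<alpha>_def by (intro Least_le) (simp add: model)
  ultimately have "model_iter \<phi> H \<alpha> = model_iter \<phi> H \<beta>"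
    using model_iter_constant_of_stable by metis
  then show ?thesis
    unfolding rationality_announcements_infinity_def T_infinity_def \<alpha>_def[symmetric] \<beta>_def[symmetric]
    by (simp add: model)
qed

end
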